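(* Let $p$ be a prime, let $k,i$ be positive integers such that either $k\leq p-2$, or $k=p-1$ and $i\geq 2$, and let $P$ be a finite $p^i$-central $p$-group of height $k$. Then $$|P:P^p|\leq|\Omega_1(P)|.$$ Moreover, if $P^p=\{x^p\mid x\in P\}$, then $|P:P^p|=|\Omega_1(P)|$.
   Context: For a finite $p$-group $P$, $\Omega_i(P)=\langle x\in P\mid x^{p^i}=1\rangle$, and $P^p$ denotes the subgroup of $P$ generated by all $p$-th powers $x^p$, $x\in P$. $\zeta_k(P)$ denotes the $k$-th term of the ascending (upper) central series of $P$, with $\zeta_1(P)=\mathrm{Z}(P)$. For $i,k\geq 1$, $P$ is called $p^i$-central of height $k$ if $\Omega_i(P)\leq\zeta_k(P)$. *)

theory Defs
  imports "HOL-Algebra.Algebra" "HOL-Computational_Algebra.Primes"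
begin

definition finite_p_group :: "nat \<Rightarrow> ('a, 'b) monoid_scheme \<Rightarrow> bool" where
  "finite_p_group p G \<longleftrightarrow> group G \<and> finite (carrier G) \<and> (\<exists>n. order G = p ^ n)"

definition group_center :: "('a, 'b) monoid_scheme \<Rightarrow> 'a set" where
  "group_center G = {z \<in> carrier G. \<forall>x \<in> carrier G. z \<otimes>\<^bsub>G\<^esub> x = x \<otimes>\<^bsub>G\<^esub> z}"

text \<open>The term at \<open>Suc k\<close> is the preimage of the center of \<open>G Mod upper_central G k\<close>
  under the canonical projection.\<close>

primrec upper_central :: "('a, 'b) monoid_scheme \<Rightarrow> nat \<Rightarrow> 'a set" where
  "upper_central G 0 = {\<one>\<^bsub>G\<^esub>}"
| "upper_central G (Suc k) =
     {x \<in> carrier G. upper_central G k #>\<^bsub>G\<^esub> x \<in> group_center (G Mod upper_central G k)}"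

definition Omega :: "nat \<Rightarrow> nat \<Rightarrow> ('a, 'b) monoid_scheme \<Rightarrow> 'a set" where
  "Omega p i G = generate G {x \<in> carrier G. x [^]\<^bsub>G\<^esub> (p ^ i) = \<one>\<^bsub>G\<^esub>}"

definition power_set :: "nat \<Rightarrow> ('a, 'b) monoid_scheme \<Rightarrow> 'a set" where
  "power_set m G = {x [^]\<^bsub>G\<^esub> m | x. x \<in> carrier G}"

definition power_subgroup :: "nat \<Rightarrow> ('a, 'b) monoid_scheme \<Rightarrow> 'a set" where
  "power_subgroup m G = generate G (power_set m G)"

definition group_index :: "('a, 'b) monoid_scheme \<Rightarrow> 'a set \<Rightarrow> nat" where
  "group_index G H = card (rcosets\<^bsub>G\<^esub> H)"

definition central_of_height :: "nat \<Rightarrow> nat \<Rightarrow> nat \<Rightarrow> ('a, 'b) monoid_scheme \<Rightarrow> bool" where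
  "central_of_height p i k G \<longleftrightarrow> Omega p i G \<subseteq> upper_central G k"

lemma (in group) group_center_normal: "group_center G \<lhd> G"
proof -
  have "subgroup (group_center G) G"
  proof
    fix x assume x: "x \<in> group_center G"
    have xc: "x \<in> carrier G"
      using x by (simp add: group_center_def)
    have xm: "x \<otimes> w = w \<otimes> x" if "w \<in> carrier G" for w
      using x that by (auto simp: group_center_def)
    show "inv x \<in> group_center G"
      using x by (auto simp: group_center_def) (metis inv_closed inv_inv inv_mult_group)
    fix y assume y: "y \<in> group_center G"
    have "x \<otimes> y \<otimes> w = w \<otimes> (x \<otimes> y)" if w: "w \<in> carrier G" for w
    proof -
      have yc: "y \<in> carrier G" and yw: "y \<otimes> w = w \<otimes> y"
        using y w by (auto simp: group_center_def)
      have "x \<otimes> y \<otimes> w = x \<otimes> w \<otimes> y"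
        using xc yc w yw by (simp add: m_assoc)
      also have "\<dots> = w \<otimes> (x \<otimes> y)"
        using xc yc w xm[OF w] by (simp add: m_assoc)
      finally show ?thesis .
    qed
    moreover have "x \<otimes> y \<in> carrier G"
      using x y unfolding group_center_def by blast
    ultimately show "x \<otimes> y \<in> group_center G"
      unfolding group_center_def by blast
  qed (auto simp: group_center_def)
  moreover have "x \<otimes> z \<otimes> inv x \<in> group_center G"
    if x: "x \<in> carrier G" and z: "z \<in> group_center G" for x z
  proof -
    have zc: "z \<in> carrier G" and zx: "x \<otimes> z = z \<otimes> x"
      using x z by (auto simp: group_center_def)
    have "x \<otimes> z \<otimes> inv x = z"
      unfolding zx using x zc by (simp add: m_assoc)
    then show ?thesis using z by simp
  qed
  ultimately show ?thesis using normal_inv_iff by blast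
qed

lemma (in group) upper_central_normal: "upper_central G k \<lhd> G"
proof (induction k)
  case 0
  show ?case by (simp add: one_is_normal)
next
  case (Suc k)
  interpret N: normal "upper_central G k" G by fact
  let ?Q = "G Mod upper_central G k"
  interpret Q: group ?Q by (rule N.factorgroup_is_group)
  interpret h: group_hom G ?Q "\<lambda>x. upper_central G k #> x"
    by unfold_locales (rule N.r_coset_hom_Mod)
  interpret Z: normal "group_center ?Q" ?Q by (rule Q.group_center_normal)
  have "subgroup (upper_central G (Suc k)) G"
  proof
    show "\<one> \<in> upper_central G (Suc k)"
      using Z.one_closed unfolding h.hom_one[symmetric] by simp
    fix x assume x: "x \<in> upper_central G (Suc k)"
    then show "inv x \<in> upper_central G (Suc k)"
      using Z.m_inv_closed by (simp add: h.hom_inv)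
    fix y assume "y \<in> upper_central G (Suc k)"
    with x show "x \<otimes> y \<in> upper_central G (Suc k)"
      using Z.m_closed by (simp add: h.hom_mult)
  qed auto
  moreover have "x \<otimes> z \<otimes> inv x \<in> upper_central G (Suc k)"
    if "x \<in> carrier G" "z \<in> upper_central G (Suc k)" for x z
    using that Z.inv_op_closed2[of "upper_central G k #> x" "upper_central G k #> z"]
    by (simp add: h.hom_mult h.hom_inv h.hom_closed)
  ultimately show ?case using normal_inv_iff by blast
qed

lemma (in group) upper_central_1: "upper_central G (Suc 0) = group_center G"
proof -
  have coset: "{\<one>} #> x = {x}" if "x \<in> carrier G" for x
    using that by (simp add: r_coset_def)
  have carr: "carrier (G Mod {\<one>}) = (\<lambda>x. {x}) ` carrier G"
    using coset by (auto simp: FactGroup_def RCOSETS_def)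
  have mult: "{x} \<otimes>\<^bsub>G Mod {\<one>}\<^esub> {y} = {x \<otimes> y}" for x y
    by (simp add: FactGroup_def set_mult_def)
  have "{\<one>} #> x \<in> group_center (G Mod {\<one>}) \<longleftrightarrow> x \<in> group_center G"
    if x: "x \<in> carrier G" for x
    unfolding group_center_def coset[OF x] carr mem_Collect_eq ball_simps mult singleton_inject
    using x by (simp del: mult_FactGroup add: mult)
  then show ?thesis
    by (auto simp: group_center_def)
qed

end

theory Submission
  imports Defs
begin

text \<open>
  Let \<open>E = {x. x\<^sup>p = 1}\<close>. The theorem follows by counting once \<open>E\<close> is a subgroup and
  the fibres of \<open>x \<mapsto> x\<^sup>p\<close> are the cosets of \<open>E\<close>.

  The engine is a substitute for Hall's collection formula. In a group with a filtration that is
  trivial in degree \<open>p\<close>, polynomial sequences form a group and have Taylor expansions, so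
  \<open>x\<^sup>-\<^sup>p y\<^sup>p = (x\<^sup>-\<^sup>1 y)\<^sup>p\<close> as soon as the commutators lie in a subgroup of
  exponent \<open>p\<close>. Subgroups \<open>\<langle>x, z\<rangle>\<close> with \<open>z \<in> \<zeta>\<^sub>k(P)\<close> have class at most
  \<open>k < p\<close>, which gives closure of \<open>E\<close> under products and \<open>(x z)\<^sup>p = x\<^sup>p\<close> for
  \<open>z \<in> E\<close>.

  If \<open>x\<^sup>p = y\<^sup>p\<close>, then \<open>x\<close> and \<open>y\<^sup>-\<^sup>1 x y\<close> lie in a proper subgroup of
  \<open>\<langle>x, y\<rangle>\<close> and have equal \<open>p\<close>-th powers, so by induction \<open>[x, y] \<in> E\<close>. Hence
  \<open>\<langle>x, y\<rangle>\<close> has class at most \<open>k + 1\<close>, which suffices for \<open>k \<le> p - 2\<close>. For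
  \<open>k = p - 1\<close> and \<open>i \<ge> 2\<close>, the element \<open>w = x\<^sup>-\<^sup>1 y\<close> satisfies \<open>w\<^sup>p \<in> E\<close>,
  so \<open>w \<in> \<Omega>\<^sub>2(P) \<le> \<zeta>\<^sub>k(P)\<close> and \<open>\<langle>x, w\<rangle>\<close> has class at most \<open>k\<close>.
\<close>

section \<open>Polynomial sequences in filtered groups\<close>

definition commutator :: "('a, 'b) monoid_scheme \<Rightarrow> 'a \<Rightarrow> 'a \<Rightarrow> 'a" where
  "commutator G a b = inv\<^bsub>G\<^esub> a \<otimes>\<^bsub>G\<^esub> inv\<^bsub>G\<^esub> b \<otimes>\<^bsub>G\<^esub> a \<otimes>\<^bsub>G\<^esub> b"

section \<open>Commutator calculus in a group\<close>

context group
begin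

abbreviation cmt :: "'a \<Rightarrow> 'a \<Rightarrow> 'a" where
  "cmt \<equiv> commutator G"

lemma inv_cancel_left:
  "x \<in> carrier G \<Longrightarrow> y \<in> carrier G \<Longrightarrow> x \<otimes> (inv x \<otimes> y) = y"
  "x \<in> carrier G \<Longrightarrow> y \<in> carrier G \<Longrightarrow> inv x \<otimes> (x \<otimes> y) = y"
  by (simp_all flip: m_assoc)

text \<open>Rewriting with these rules brings group words to reduced, right-associated form, so
  \<open>simp\<close> settles identities that hold in free groups.\<close>

lemmas group_word = m_assoc inv_mult_group inv_cancel_left commutator_def

lemma commutator_closed [simp, intro]:
  "a \<in> carrier G \<Longrightarrow> b \<in> carrier G \<Longrightarrow> cmt a b \<in> carrier G"
  by (simp add: commutator_def)

lemma inv_commutator: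
  "a \<in> carrier G \<Longrightarrow> b \<in> carrier G \<Longrightarrow> inv (cmt a b) = cmt b a"
  by (simp add: group_word)

lemma commutator_mult_left:
  "a \<in> carrier G \<Longrightarrow> b \<in> carrier G \<Longrightarrow> c \<in> carrier G \<Longrightarrow>
    cmt (a \<otimes> b) c = inv b \<otimes> cmt a c \<otimes> b \<otimes> cmt b c"
  by (simp add: group_word)

lemma commutator_inv_left:
  "a \<in> carrier G \<Longrightarrow> c \<in> carrier G \<Longrightarrow> cmt (inv a) c = a \<otimes> inv (cmt a c) \<otimes> inv a"
  by (simp add: group_word)

text \<open>The Hall-Witt identity solved for one of its three factors. A subgroup that is stable
  under the conjugations involved and contains the other two double commutators then contains this
  one.\<close>

lemma hall_witt:
  assumes "g \<in> carrier G" "h \<in> carrier G" "u \<in> carrier G"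
  shows "cmt (cmt g h) u =
    inv h \<otimes> inv ((inv u \<otimes> cmt (cmt (inv h) (inv u)) g \<otimes> u) \<otimes>
      (inv g \<otimes> cmt (cmt u (inv g)) (inv h) \<otimes> g)) \<otimes> h"
  using assms by (simp add: group_word)

text \<open>If \<open>a\<close> and \<open>b\<close> are the increments of two sequences at
  \<open>g\<close> and \<open>h\<close>, cancelling \<open>c\<close> on the left gives the increment
  of their commutator. Every remaining factor involves \<open>a\<close> or \<open>b\<close> and
  hence has higher degree.\<close>

lemma commutator_mult_mult:
  assumes "g \<in> carrier G" "h \<in> carrier G" "a \<in> carrier G" "b \<in> carrier G"
  defines "c \<equiv> cmt g h" and "d \<equiv> cmt a h" and "e \<equiv> cmt (g \<otimes> a) b"
  shows "cmt (g \<otimes> a) (h \<otimes> b) = c \<otimes> (e \<otimes> cmt e c \<otimes> (cmt c (a \<otimes> b) \<otimes> (d \<otimes> cmt d b)))"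
proof -
  have "cmt (g \<otimes> a) (h \<otimes> b) = e \<otimes> inv b \<otimes> cmt (g \<otimes> a) h \<otimes> b"
    using assms(1-4) by (simp add: e_def group_word)
  also have "cmt (g \<otimes> a) h = inv a \<otimes> c \<otimes> a \<otimes> d"
    unfolding c_def d_def using assms(1-4) by (simp add: commutator_mult_left)
  finally have "cmt (g \<otimes> a) (h \<otimes> b) = e \<otimes> inv b \<otimes> (inv a \<otimes> c \<otimes> a \<otimes> d) \<otimes> b" .
  moreover have "c \<in> carrier G" "d \<in> carrier G" "e \<in> carrier G"
    using assms(1-4) by (auto simp: c_def d_def e_def)
  ultimately show ?thesis
    using assms(1-4) by (simp add: m_assoc inv_mult_group inv_cancel_left commutator_def[of G _ b]
        commutator_def[of G e] commutator_def[of G c])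
qed

end

locale filtration = group +
  fixes F :: "nat \<Rightarrow> 'a set"
  assumes F_subgroup: "subgroup (F i) G"
    and F_Suc: "F (Suc i) \<subseteq> F i"
    and F_commutator: "a \<in> F i \<Longrightarrow> b \<in> F j \<Longrightarrow> cmt a b \<in> F (i + j)"
begin

lemma F_carrier: "a \<in> F i \<Longrightarrow> a \<in> carrier G"
  by (rule subgroup.mem_carrier[OF F_subgroup])

lemma F_mult: "a \<in> F i \<Longrightarrow> b \<in> F i \<Longrightarrow> a \<otimes> b \<in> F i"
  by (rule subgroup.m_closed[OF F_subgroup])

lemma F_inv: "a \<in> F i \<Longrightarrow> inv a \<in> F i"
  by (rule subgroup.m_inv_closed[OF F_subgroup])

lemma F_one: "\<one> \<in> F i"
  by (rule subgroup.one_closed[OF F_subgroup])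

lemma F_antimono: "i \<le> j \<Longrightarrow> F j \<subseteq> F i"
  by (rule lift_Suc_antimono_le[of F]) (use F_Suc in auto)

definition diff :: "(nat \<Rightarrow> 'a) \<Rightarrow> nat \<Rightarrow> 'a" where
  "diff g n = inv (g n) \<otimes> g (Suc n)"

text \<open>Membership in \<open>poly d i\<close> constrains the iterated differences up to order \<open>d\<close> only. This
  truncation makes the closure properties provable by induction on \<open>d\<close>, since the difference of
  a commutator again contains that commutator.\<close>

primrec poly :: "nat \<Rightarrow> nat \<Rightarrow> (nat \<Rightarrow> 'a) \<Rightarrow> bool" where
  "poly 0 i g \<longleftrightarrow> (\<forall>n. g n \<in> F i)"
| "poly (Suc d) i g \<longleftrightarrow> (\<forall>n. g n \<in> F i) \<and> poly d (Suc i) (diff g)"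

lemma poly_mem: "poly d i g \<Longrightarrow> g n \<in> F i"
  by (cases d) auto

lemma poly_SucD: "poly (Suc d) i g \<Longrightarrow> poly d i g"
  by (induction d arbitrary: i g) auto

lemma poly_antimono: "poly d j g \<Longrightarrow> i \<le> j \<Longrightarrow> poly d i g"
proof (induction d arbitrary: i j g)
  case 0
  then show ?case using F_antimono by fastforce
next
  case (Suc d)
  then have "poly d (Suc i) (diff g)" by (metis Suc_le_mono poly.simps(2))
  with Suc.prems show ?case using F_antimono by fastforce
qed

lemma poly_shift: "poly d i g \<Longrightarrow> poly d i (\<lambda>n. g (Suc n))"
proof (induction d arbitrary: i g)
  case (Suc d)
  have "diff (\<lambda>n. g (Suc n)) = (\<lambda>n. diff g (Suc n))"
    by (simp add: diff_def fun_eq_iff)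
  with Suc show ?case by simp
qed auto

text \<open>A truncated form of the Lazard-Leibman theorem. The induction must be joint: differences
  of products and inverses contain commutators, and differences of commutators contain
  products.\<close>

lemma poly_closed:
  "(\<forall>i g h. poly d i g \<longrightarrow> poly d i h \<longrightarrow> poly d i (\<lambda>n. g n \<otimes> h n)) \<and>
   (\<forall>i g. poly d i g \<longrightarrow> poly d i (\<lambda>n. inv (g n))) \<and>
   (\<forall>i j g h. poly d i g \<longrightarrow> poly d j h \<longrightarrow> poly d (i + j) (\<lambda>n. cmt (g n) (h n)))"
proof (induction d)
  case 0
  then show ?case by (auto intro: F_mult F_inv F_commutator)
next
  case (Suc d)
  note mult = Suc[THEN conjunct1, rule_format]
    and inv = Suc[THEN conjunct2, THEN conjunct1, rule_format]
    and comm = Suc[THEN conjunct2, THEN conjunct2, rule_format]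
  have M: "poly (Suc d) i (\<lambda>n. g n \<otimes> h n)" if g: "poly (Suc d) i g" and h: "poly (Suc d) i h" for i g h
  proof -
    have dg: "poly d (Suc i) (diff g)" and dh: "poly d (Suc i) (diff h)"
      using g h by auto
    have carr: "g n \<in> carrier G" "h n \<in> carrier G" for n
      using g h F_carrier by auto
    have "diff (\<lambda>n. g n \<otimes> h n) = (\<lambda>n. diff g n \<otimes> cmt (diff g n) (h n) \<otimes> diff h n)"
      using carr by (simp add: fun_eq_iff diff_def group_word)
    moreover have "poly d (Suc i) (\<lambda>n. cmt (diff g n) (h n))"
      using comm[OF dg poly_SucD[OF h]] by (rule poly_antimono) auto
    ultimately have "poly d (Suc i) (diff (\<lambda>n. g n \<otimes> h n))"
      using mult dg dh by simp
    then show ?thesis using g h F_mult by simp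
  qed
  have I: "poly (Suc d) i (\<lambda>n. inv (g n))" if g: "poly (Suc d) i g" for i g
  proof -
    have dg: "poly d (Suc i) (diff g)"
      using g by auto
    have carr: "g n \<in> carrier G" for n
      using g F_carrier by auto
    have "diff (\<lambda>n. inv (g n)) = (\<lambda>n. inv (diff g n) \<otimes> cmt (inv (diff g n)) (inv (g n)))"
      using carr by (simp add: fun_eq_iff diff_def group_word)
    moreover have "poly d (Suc i) (\<lambda>n. cmt (inv (diff g n)) (inv (g n)))"
      using comm[OF inv[OF dg] inv[OF poly_SucD[OF g]]] by (rule poly_antimono) auto
    ultimately have "poly d (Suc i) (diff (\<lambda>n. inv (g n)))"
      using mult inv[OF dg] by simp
    then show ?thesis using g F_inv by simp
  qed
  have C: "poly (Suc d) (i + j) (\<lambda>n. cmt (g n) (h n))"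
    if g: "poly (Suc d) i g" and h: "poly (Suc d) j h" for i j g h
  proof -
    have dg: "poly d (Suc i) (diff g)" and dh: "poly d (Suc j) (diff h)"
      using g h by auto
    have carr: "g n \<in> carrier G" "h n \<in> carrier G" for n
      using g h F_carrier by auto
    define c e where "c = (\<lambda>n. cmt (g n) (h n))"
      and "e = (\<lambda>n. cmt (g (Suc n)) (diff h n))"
    have c: "poly d (i + j) c"
      unfolding c_def using comm g h poly_SucD by blast
    have ah: "poly d (Suc (i + j)) (\<lambda>n. cmt (diff g n) (h n))"
      using comm[OF dg poly_SucD[OF h]] by simp
    have e: "poly d (Suc (i + j)) e"
      unfolding e_def using comm[OF poly_shift[OF poly_SucD[OF g]] dh] by simp
    have ec: "poly d (Suc (i + j)) (\<lambda>n. cmt (e n) (c n))"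
      using comm[OF e c] by (rule poly_antimono) simp
    \<comment> \<open>Degree \<open>1\<close> is a common lower bound for \<open>Suc i\<close> and
      \<open>Suc j\<close>, and it suffices to raise the degree \<open>i + j\<close> of
      \<open>c\<close> by one.\<close>
    have "poly d 1 (\<lambda>n. diff g n \<otimes> diff h n)"
      by (intro mult poly_antimono[OF dg] poly_antimono[OF dh]) auto
    from comm[OF c this] have cab: "poly d (Suc (i + j)) (\<lambda>n. cmt (c n) (diff g n \<otimes> diff h n))"
      by simp
    have ahb: "poly d (Suc (i + j)) (\<lambda>n. cmt (cmt (diff g n) (h n)) (diff h n))"
      using comm[OF ah dh] by (rule poly_antimono) simp
    have "poly d (Suc (i + j)) (\<lambda>n. e n \<otimes> cmt (e n) (c n) \<otimes>
        (cmt (c n) (diff g n \<otimes> diff h n) \<otimes>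
          (cmt (diff g n) (h n) \<otimes> cmt (cmt (diff g n) (h n)) (diff h n))))"
      by (intro mult e ec cab ah ahb)
    moreover have "diff c = (\<lambda>n. e n \<otimes> cmt (e n) (c n) \<otimes>
        (cmt (c n) (diff g n \<otimes> diff h n) \<otimes>
          (cmt (diff g n) (h n) \<otimes> cmt (cmt (diff g n) (h n)) (diff h n))))"
    proof
      fix n
      have a: "diff g n \<in> carrier G" "diff h n \<in> carrier G"
        and Suc: "g (Suc n) = g n \<otimes> diff g n" "h (Suc n) = h n \<otimes> diff h n"
        using carr by (simp_all add: diff_def inv_cancel_left)
      have "c n \<in> carrier G" "e n \<in> carrier G"
        using carr a by (auto simp: c_def e_def)
      then show "diff c n = e n \<otimes> cmt (e n) (c n) \<otimes>
        (cmt (c n) (diff g n \<otimes> diff h n) \<otimes>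
          (cmt (diff g n) (h n) \<otimes> cmt (cmt (diff g n) (h n)) (diff h n)))"
        unfolding diff_def[of c] c_def[THEN fun_cong, of "Suc n"] Suc
          commutator_mult_mult[OF carr a]
        using carr a by (simp add: c_def e_def Suc inv_cancel_left)
    qed
    ultimately show ?thesis
      using g h F_commutator by (simp add: c_def)
  qed
  show ?case
    by (intro conjI allI impI M I C)
qed

lemmas poly_mult = poly_closed[THEN conjunct1, rule_format]
  and poly_inv = poly_closed[THEN conjunct2, THEN conjunct1, rule_format]

lemma F_pow: "a \<in> F i \<Longrightarrow> a [^] (n::nat) \<in> F i"
  by (induction n) (auto intro: F_mult F_one)

text \<open>By Pascal's rule, taking the difference lowers \<open>j\<close> by one while the
  required degree \<open>i\<close> rises by one, so \<open>i + j\<close> is preserved.\<close>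

lemma poly_pow_choose: "a \<in> F (i + j) \<Longrightarrow> poly d i (\<lambda>n. a [^] (n choose j))"
proof (induction d arbitrary: a i j)
  case 0
  then show ?case using F_pow F_antimono[of i "i + j"] by auto
next
  case (Suc d)
  have "a \<in> F i"
    using Suc.prems F_antimono[of i "i + j"] by auto
  then have a: "a \<in> carrier G" "a [^] n \<in> F i" for n :: nat
    by (auto intro: F_pow F_carrier)
  have "poly d (Suc i) (diff (\<lambda>n. a [^] (n choose j)))"
  proof (cases j)
    case 0
    have "poly d (Suc i) (\<lambda>n. \<one> [^] (n choose 0))"
      by (rule Suc.IH) (simp add: F_one)
    with 0 show ?thesis using a by (simp add: diff_def[abs_def])
  next
    case (Suc l)
    have "diff (\<lambda>n. a [^] (n choose j)) = (\<lambda>n. a [^] (n choose l))"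
      using a unfolding Suc
      by (simp add: diff_def fun_eq_iff add.commute[of "_ choose l"] inv_cancel_left flip: nat_pow_mult)
    moreover have "poly d (Suc i) (\<lambda>n. a [^] (n choose l))"
      using Suc.prems Suc by (intro Suc.IH) simp
    ultimately show ?thesis by simp
  qed
  with a show ?case by simp
qed

text \<open>In the inductive step \<open>g j = \<one>\<close>, so \<open>g (Suc j)\<close> equals
  \<open>diff g j\<close>, and \<open>diff g\<close> is trivial below \<open>j\<close>. Each passage
  to the difference raises the degree by one.\<close>

lemma poly_first_value: "poly j i g \<Longrightarrow> (\<And>m. m < j \<Longrightarrow> g m = \<one>) \<Longrightarrow> g j \<in> F (i + j)"
proof (induction j arbitrary: i g)
  case (Suc j)
  have carr: "g n \<in> carrier G" for n
    using Suc.prems F_carrier by auto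
  have "diff g j \<in> F (Suc i + j)"
  proof (rule Suc.IH)
    show "poly j (Suc i) (diff g)"
      using Suc.prems by simp
  qed (simp add: diff_def Suc.prems(2))
  then show ?case using carr Suc.prems(2)[of j] by (simp add: diff_def)
qed auto

text \<open>The Taylor expansion \<open>g n = \<Prod>j. a\<^sub>j ^ (n choose j)\<close> with \<open>a\<^sub>j \<in> F j\<close> is evaluated
  at \<open>n = p\<close>, where only the factor for \<open>j = 1\<close> survives.\<close>

lemma poly_at_prime:
  assumes p: "Factorial_Ring.prime p" and trivial: "F p = {\<one>}"
    and exponent: "\<And>u. u \<in> F 2 \<Longrightarrow> u [^] p = \<one>"
    and poly: "\<And>d. poly d 0 g" and "g 0 = \<one>" and g1: "g 1 \<in> F 1"
  shows "g p = g 1 [^] p"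
proof -
  have carr: "g n \<in> carrier G" for n
    using poly[of 0] F_carrier by auto
  have p2: "p \<ge> 2" using p by (rule prime_ge_2_nat)
  \<comment> \<open>\<open>h\<close> is \<open>g\<close> with its Taylor factors up to
    \<open>j\<close> divided out. Removing those with index above \<open>1\<close> does not alter
    the value at \<open>p\<close>.\<close>
  have "j < p \<Longrightarrow> \<exists>h. (\<forall>d. poly d 0 h) \<and> (\<forall>m\<le>j. h m = \<one>) \<and> h p = inv (g 1 [^] p) \<otimes> g p"
    if "j \<ge> 1" for j
    using that
  proof (induction j rule: dec_induct)
    case base
    have "poly d 0 (\<lambda>n. inv (g 1 [^] (n choose 1)) \<otimes> g n)" for d
      by (intro poly_mult poly_inv poly_pow_choose poly) (use g1 in simp)
    moreover have "inv (g 1 [^] (m choose 1)) \<otimes> g m = \<one>" if "m \<le> 1" for m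
      using that carr \<open>g 0 = \<one>\<close> by (cases m) auto
    ultimately show ?case
      by (intro exI[of _ "\<lambda>n. inv (g 1 [^] (n choose 1)) \<otimes> g n"]) simp
  next
    case (step j)
    then obtain h where h: "\<And>d. poly d 0 h" "\<And>m. m \<le> j \<Longrightarrow> h m = \<one>"
      "h p = inv (g 1 [^] p) \<otimes> g p" by auto
    define a where "a = h (Suc j)"
    have a: "a \<in> F (Suc j)"
      using poly_first_value[OF h(1), of "Suc j"] h(2) by (simp add: a_def)
    then have ac: "a \<in> carrier G" by (rule F_carrier)
    have "a \<in> F 2"
      using a step.hyps F_antimono[of 2 "Suc j"] by auto
    moreover have "p dvd p choose Suc j"
      using p step.prems by (intro dvd_choose_prime) (auto simp: p)
    ultimately have ap: "a [^] (p choose Suc j) = \<one>"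
      using exponent ac by (auto elim!: dvdE simp flip: nat_pow_pow)
    let ?h = "\<lambda>n. inv (a [^] (n choose Suc j)) \<otimes> h n"
    have "poly d 0 ?h" for d
      by (intro poly_mult poly_inv poly_pow_choose h) (use a in simp)
    moreover have "?h m = \<one>" if "m \<le> Suc j" for m
      using that h(2) ac by (cases "m = Suc j") (auto simp: a_def binomial_eq_0)
    moreover have "?h p = inv (g 1 [^] p) \<otimes> g p"
      using ap h(3) carr by simp
    ultimately show ?case by blast
  qed
  from this[of "p - 1"] p2 obtain h where h: "\<And>d. poly d 0 h" "\<And>m. m < p \<Longrightarrow> h m = \<one>"
    "h p = inv (g 1 [^] p) \<otimes> g p" by fastforce
  \<comment> \<open>All values below \<open>p\<close> are trivial, so the value at \<open>p\<close>
    lies in \<open>F p\<close>.\<close>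
  have "h p = \<one>"
    using poly_first_value[OF h(1), of p] h(2) trivial by simp
  with h(3) have "inv (g 1 [^] p) \<otimes> g p = \<one>" by simp
  then show ?thesis
    using carr by (metis inv_solve_left' nat_pow_closed one_closed r_one)
qed

text \<open>The sequence \<open>inv (x [^] n) \<otimes> y [^] n\<close>, with \<open>n\<close>
  written as \<open>n choose 1\<close>, is polynomial, and \<open>poly_at_prime\<close> compares its
  values at \<open>1\<close> and \<open>p\<close>.\<close>

lemma power_quotient_filtration:
  assumes "Factorial_Ring.prime p" and "F p = {\<one>}"
    and "\<And>u. u \<in> F 2 \<Longrightarrow> u [^] p = \<one>"
    and x: "x \<in> F 1" and y: "y \<in> F 1"
  shows "inv (x [^] p) \<otimes> y [^] p = (inv x \<otimes> y) [^] p"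
proof -
  have carr: "x \<in> carrier G" "y \<in> carrier G"
    using x y F_carrier by auto
  have "poly d 0 (\<lambda>n. inv (x [^] (n choose 1)) \<otimes> y [^] (n choose 1))" for d
    by (intro poly_mult poly_inv poly_pow_choose) (use x y in auto)
  from poly_at_prime[OF assms(1-3) this] carr x y show ?thesis
    by (simp add: F_mult F_inv)
qed

end

section \<open>Power identities from central series\<close>

context group
begin

lemma conj_closed_if_commutator:
  assumes "subgroup N G" "u \<in> N" "cmt u h \<in> N" "h \<in> carrier G"
  shows "inv h \<otimes> u \<otimes> h \<in> N"
proof -
  have u: "u \<in> carrier G"
    using assms subgroup.mem_carrier by metis
  have "inv h \<otimes> u \<otimes> h = u \<otimes> cmt u h"
    using u assms(4) by (simp add: group_word)
  then show ?thesis
    using subgroup.m_closed[OF assms(1-3)] by simp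
qed

text \<open>The witnessing filtration consists of the elements acting trivially enough on the series
  \<open>C\<close>. Its commutator property is the pointwise Hall--Witt identity, so neither lower
  central series nor the three subgroups lemma is needed.\<close>

lemma power_quotient_central_series:
  fixes C :: "nat \<Rightarrow> 'a set"
  assumes p: "Factorial_Ring.prime p" and c: "c < p"
    and H: "subgroup H G" and N: "subgroup N G"
    and HN: "\<And>a b. a \<in> H \<Longrightarrow> b \<in> H \<Longrightarrow> cmt a b \<in> N"
    and exponent: "\<And>u. u \<in> N \<Longrightarrow> u [^] p = \<one>"
    and C: "\<And>j. subgroup (C j) G" and C0: "C 0 = {\<one>}" and Cc: "\<And>j. c \<le> j \<Longrightarrow> C j = H"
    and C_Suc: "\<And>j. C j \<subseteq> C (Suc j)"
    and C_central: "\<And>j a b. a \<in> C (Suc j) \<Longrightarrow> b \<in> H \<Longrightarrow> cmt a b \<in> C j"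
    and x: "x \<in> H" and y: "y \<in> H"
  shows "inv (x [^] p) \<otimes> y [^] p = (inv x \<otimes> y) [^] p"
proof -
  note H_carr = subgroup.mem_carrier[OF H] and C_carr = subgroup.mem_carrier[OF C]
  note C_mult = subgroup.m_closed[OF C] and C_inv = subgroup.m_inv_closed[OF C]
  note H_mult = subgroup.m_closed[OF H] and H_inv = subgroup.m_inv_closed[OF H]
  have C_mono: "C i \<subseteq> C j" if "i \<le> j" for i j
    using that C_Suc by (rule lift_Suc_mono_le[rotated])
  have C_H: "C j \<subseteq> H" for j
    using C_mono[of j "max j c"] Cc[of "max j c"] by simp
  \<comment> \<open>Truncated subtraction also covers \<open>j = 0\<close>, where \<open>C 0\<close>
    is trivial.\<close>
  have C_commutator: "cmt a b \<in> C (j - 1)" if "a \<in> C j" "b \<in> H" for a b j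
  proof (cases j)
    case 0
    then show ?thesis
      using that C0 H_carr subgroup.one_closed[OF C] by (simp add: commutator_def)
  next
    case (Suc l)
    then show ?thesis using C_central that by simp
  qed
  have C_conj: "inv h \<otimes> u \<otimes> h \<in> C j" if "u \<in> C j" "h \<in> H" for u h j
    using C that(1) _ H_carr[OF that(2)]
  proof (rule conj_closed_if_commutator)
    show "cmt u h \<in> C j"
      using C_commutator[OF that] C_mono[of "j - 1" j] by auto
  qed
  have C_swap: "cmt a b \<in> C j" if "cmt b a \<in> C j" "a \<in> carrier G" "b \<in> carrier G" for a b j
    using C_inv[OF that(1)] that(2,3) by (simp add: inv_commutator)
  \<comment> \<open>The last condition says that \<open>g\<close> lowers the series by
    \<open>i\<close> steps. Membership in \<open>C (Suc c - i)\<close> makes \<open>F p\<close>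
    trivial, and membership in \<open>N\<close> from degree \<open>2\<close> on supplies the
    exponent.\<close>
  define F where "F i = {g \<in> H. (2 \<le> i \<longrightarrow> g \<in> N) \<and> g \<in> C (Suc c - i) \<and>
    (\<forall>j. \<forall>u \<in> C j. cmt g u \<in> C (j - i))}" for i
  have F_D: "g \<in> H" "g \<in> carrier G" "2 \<le> i \<Longrightarrow> g \<in> N" "g \<in> C (Suc c - i)"
    "u \<in> C j \<Longrightarrow> cmt g u \<in> C (j - i)" if "g \<in> F i" for g i u j
    using that H_carr by (auto simp: F_def)
  have F_subgroup: "subgroup (F i) G" for i
  proof
    show "F i \<subseteq> carrier G"
      using F_D(2) by blast
    show "\<one> \<in> F i"
      using subgroup.one_closed[OF H] subgroup.one_closed[OF N] subgroup.one_closed[OF C] C_carr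
      by (auto simp: F_def commutator_def)
  next
    fix g h assume gh: "g \<in> F i" "h \<in> F i"
    have "cmt (g \<otimes> h) u \<in> C (j - i)" if u: "u \<in> C j" for u j
    proof -
      have "cmt (g \<otimes> h) u = inv h \<otimes> cmt g u \<otimes> h \<otimes> cmt h u"
        using gh F_D(2) u C_carr by (intro commutator_mult_left)
      then show ?thesis
        using C_mult[OF C_conj[OF F_D(5)[OF gh(1) u] F_D(1)[OF gh(2)]] F_D(5)[OF gh(2) u]] by simp
    qed
    then show "g \<otimes> h \<in> F i"
      using gh H_mult C_mult subgroup.m_closed[OF N] by (auto simp: F_def)
  next
    fix g assume g: "g \<in> F i"
    have "cmt (inv g) u \<in> C (j - i)" if u: "u \<in> C j" for u j
    proof -
      have "cmt (inv g) u = inv (inv g) \<otimes> inv (cmt g u) \<otimes> inv g"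
        using g F_D(2) u C_carr by (simp add: commutator_inv_left)
      then show ?thesis
        using C_conj[OF C_inv[OF F_D(5)[OF g u]] H_inv[OF F_D(1)[OF g]]] by simp
    qed
    then show "inv g \<in> F i"
      using g H_inv C_inv subgroup.m_inv_closed[OF N] by (auto simp: F_def)
  qed
  note F_inv = subgroup.m_inv_closed[OF F_subgroup]
  have F_commutator: "cmt g h \<in> F (i + j)" if g: "g \<in> F i" and h: "h \<in> F j" for g h i j
  proof -
    have carr: "g \<in> carrier G" "h \<in> carrier G"
      using g h F_D(2) by auto
    have "cmt g h \<in> H"
      using g h F_D(1) H_mult H_inv by (simp add: commutator_def)
    moreover have "cmt g h \<in> N"
      using g h F_D(1) HN by blast
    moreover have "cmt g h \<in> C (Suc c - (i + j))"
      using F_D(5)[OF g F_D(4)[OF h]] by (simp add: diff_diff_left add.commute)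
    moreover have "cmt (cmt g h) u \<in> C (l - (i + j))" if u: "u \<in> C l" for u l
    proof -
      have uH: "u \<in> H" and uc: "u \<in> carrier G"
        using subsetD[OF C_H u] C_carr[OF u] by simp_all
      \<comment> \<open>In both remaining Hall-Witt factors, inverses or conjugates aside,
        \<open>g\<close> and \<open>h\<close> act on \<open>u\<close> one after the other and lower
        the index by \<open>i\<close> and \<open>j\<close>, in either order.\<close>
      have "cmt (inv h) (inv u) \<in> C (l - j)"
        using F_D(5)[OF F_inv[OF h] C_inv[OF u]] .
      from F_D(5)[OF g this] have "cmt g (cmt (inv h) (inv u)) \<in> C (l - (i + j))"
        by (simp add: diff_diff_left add.commute)
      then have "cmt (cmt (inv h) (inv u)) g \<in> C (l - (i + j))"
        by (rule C_swap) (use carr uc in auto)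
      from C_conj[OF this uH]
      have 1: "inv u \<otimes> cmt (cmt (inv h) (inv u)) g \<otimes> u \<in> C (l - (i + j))" .
      have "cmt u (inv g) \<in> C (l - i)"
        using F_D(5)[OF F_inv[OF g] u] by (rule C_swap) (use carr uc in auto)
      from F_D(5)[OF F_inv[OF h] this] have "cmt (inv h) (cmt u (inv g)) \<in> C (l - (i + j))"
        by (simp add: diff_diff_left)
      then have "cmt (cmt u (inv g)) (inv h) \<in> C (l - (i + j))"
        by (rule C_swap) (use carr uc in auto)
      from C_conj[OF this F_D(1)[OF g]]
      have 2: "inv g \<otimes> cmt (cmt u (inv g)) (inv h) \<otimes> g \<in> C (l - (i + j))" .
      show ?thesis
        unfolding hall_witt[OF carr uc] by (rule C_conj[OF C_inv[OF C_mult[OF 1 2]] F_D(1)[OF h]])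
    qed
    ultimately show ?thesis by (simp add: F_def)
  qed
  have "F (Suc i) \<subseteq> F i" for i
  proof
    fix g assume g: "g \<in> F (Suc i)"
    have "C (Suc c - Suc i) \<subseteq> C (Suc c - i)" "\<And>j. C (j - Suc i) \<subseteq> C (j - i)"
      by (intro C_mono diff_le_mono2; simp)+
    with g show "g \<in> F i"
      by (fastforce simp: F_def)
  qed
  from filtration.intro[OF group_axioms filtration_axioms.intro[OF F_subgroup this F_commutator]]
  interpret filtration G F .
  have F1: "F 1 = H"
  proof
    show "F 1 \<subseteq> H" using F_D(1) by blast
    show "H \<subseteq> F 1"
    proof
      fix g assume g: "g \<in> H"
      have "cmt g u \<in> C (j - 1)" if u: "u \<in> C j" for u j
        using C_commutator[OF u g] by (rule C_swap) (use H_carr[OF g] C_carr[OF u] in auto)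
      with g Cc[of c] show "g \<in> F 1" by (simp add: F_def)
    qed
  qed
  have "F p = {\<one>}"
  proof -
    have "F p \<subseteq> C 0"
      using F_D(4)[of _ p] c by (metis Suc_leI diff_is_0_eq subsetI)
    then show ?thesis
      using C0 F_one[of p] by auto
  qed
  then show ?thesis
    by (rule power_quotient_filtration[OF p _ exponent[OF F_D(3)]]) (use x y F1 in auto)
qed

text \<open>For fixed \<open>t\<close>, the identities for products and inverses extend
  \<open>cmt w t \<in> N\<close> from generators \<open>w\<close> to all words. This is used twice:
  first with \<open>t\<close> a generator, then, after inverting the commutator, with
  \<open>t = v\<close>.\<close>

lemma generate_commutator_closed:
  assumes S: "S \<subseteq> carrier G" and N: "subgroup N G"
    and norm: "\<And>n h. n \<in> N \<Longrightarrow> h \<in> generate G S \<Longrightarrow> inv h \<otimes> n \<otimes> h \<in> N"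
    and comm: "\<And>s t. s \<in> S \<Longrightarrow> t \<in> S \<Longrightarrow> cmt s t \<in> N"
    and u: "u \<in> generate G S" and v: "v \<in> generate G S"
  shows "cmt u v \<in> N"
proof -
  note gen = generate_is_subgroup[OF S]
  note carr = subgroup.mem_carrier[OF gen] and gen_inv = subgroup.m_inv_closed[OF gen]
  note N_mult = subgroup.m_closed[OF N] and N_inv = subgroup.m_inv_closed[OF N]
  have left: "cmt w t \<in> N"
    if w: "w \<in> generate G S" and t: "t \<in> generate G S" and st: "\<And>s. s \<in> S \<Longrightarrow> cmt s t \<in> N" for w t
    using w
  proof (induction w rule: generate.induct)
    case one
    then show ?case using carr[OF t] subgroup.one_closed[OF N] by (simp add: commutator_def)
  next
    case (incl s)
    then show ?case by (rule st)
  next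
    case (inv s)
    have s: "s \<in> generate G S" using inv by (rule generate.incl)
    have "cmt (inv s) t = inv (inv s) \<otimes> inv (cmt s t) \<otimes> inv s"
      using carr[OF s] carr[OF t] by (simp add: commutator_inv_left)
    then show ?case
      using norm[OF N_inv[OF st[OF inv]] gen_inv[OF s]] by simp
  next
    case (eng a b)
    then show ?case
      using commutator_mult_left[OF carr carr carr[OF t], of a b] N_mult norm by simp
  qed
  have "cmt v s \<in> N" if s: "s \<in> S" for s
    by (rule left[OF v generate.incl[OF s]]) (rule comm[OF _ s])
  then have "cmt s v \<in> N" if "s \<in> S" for s
    using N_inv that inv_commutator[of v s] carr[OF v] S by fastforce
  then show ?thesis
    by (rule left[OF u v])
qed

lemma generate_pair_commutator_closed:
  assumes x: "x \<in> carrier G" and z: "z \<in> carrier G" and N: "subgroup N G"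
    and norm: "\<And>n h. n \<in> N \<Longrightarrow> h \<in> generate G {x, z} \<Longrightarrow> inv h \<otimes> n \<otimes> h \<in> N"
    and xz: "cmt x z \<in> N"
    and u: "u \<in> generate G {x, z}" and v: "v \<in> generate G {x, z}"
  shows "cmt u v \<in> N"
proof (rule generate_commutator_closed[OF _ N norm _ u v])
  have "cmt z x \<in> N"
    using subgroup.m_inv_closed[OF N xz] x z by (simp add: inv_commutator)
  moreover have "cmt x x \<in> N" "cmt z z \<in> N"
    using subgroup.one_closed[OF N] x z by (simp_all add: group_word)
  ultimately show "cmt s t \<in> N" if "s \<in> {x, z}" "t \<in> {x, z}" for s t
    using that xz by auto
qed (use x z in auto)

end

section \<open>Proper subgroups of finite p-groups\<close>

text \<open>Without another fixed point, all orbits but \<open>{x}\<close> have length a positive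
  power of \<open>p\<close>, so \<open>p\<close> divides both \<open>card E\<close> and
  \<open>card E - 1\<close>.\<close>

lemma (in group_action) second_fixed_point:
  assumes p: "Factorial_Ring.prime p" and order: "order G = p ^ n" and fin: "finite E"
    and dvd: "p dvd card E" and x: "x \<in> E" and fixed: "\<And>g. g \<in> carrier G \<Longrightarrow> \<phi> g x = x"
  shows "\<exists>y \<in> E. y \<noteq> x \<and> (\<forall>g \<in> carrier G. \<phi> g y = y)"
proof (rule ccontr)
  assume no: "\<not> ?thesis"
  have one: "\<one> \<in> carrier G"
    using group_hom group_hom.axioms(1) group.is_monoid monoid.one_closed by metis
  have orbit_x: "orbit G \<phi> x = {x}"
    using fixed[OF one] fixed one unfolding orbit_def by (smt (verit) Collect_cong singleton_conv)
  let ?C = "orbits G E \<phi> - {{x}}"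
  have union: "\<Union> (orbits G E \<phi>) = E"
    by (rule orbits_coverture)
  have x_orbit: "{x} \<in> orbits G E \<phi>"
    using x orbit_x unfolding orbits_def by blast
  have disj: "A = B \<or> A \<inter> B = {}" if "A \<in> orbits G E \<phi>" "B \<in> orbits G E \<phi>" for A B
    using disjoint_union that by blast
  have E_eq: "\<Union> ?C = E - {x}"
  proof
    show "\<Union> ?C \<subseteq> E - {x}"
    proof
      fix y assume "y \<in> \<Union> ?C"
      then obtain A where A: "A \<in> orbits G E \<phi>" "A \<noteq> {x}" "y \<in> A" by blast
      then have "A \<inter> {x} = {}"
        using disj[OF A(1) x_orbit] by blast
      with A union show "y \<in> E - {x}" by blast
    qed
    show "E - {x} \<subseteq> \<Union> ?C"
      using union by blast
  qed
  have "p dvd card A" if A: "A \<in> ?C" for A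
  proof -
    from A obtain y where y: "y \<in> E" "A = orbit G \<phi> y" "A \<noteq> {x}"
      unfolding orbits_def by blast
    have "card A * card (stabilizer G \<phi> y) = p ^ n"
      using orbit_stabilizer_theorem[OF y(1)] y(2) order by simp
    then have "card A dvd p ^ n" by (metis dvd_triv_left)
    then obtain m where m: "card A = p ^ m"
      using p by (auto simp: divides_primepow_nat)
    have yA: "y \<in> A"
      using orbit_refl y by simp
    have "m \<noteq> 0"
    proof
      assume "m = 0"
      with m have "card A = 1" by simp
      then have A_eq: "A = {y}"
        using yA by (metis card_1_singletonE singletonD)
      then have "\<forall>g \<in> carrier G. \<phi> g y = y"
        using y(2) unfolding orbit_def by blast
      with no y(1) have "y = x" by blast
      with A_eq y(3) show False by simp
    qed
    with m show ?thesis by simp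
  qed
  moreover have "pairwise disjnt ?C"
    using disj by (auto simp: pairwise_def disjnt_def)
  ultimately have "p dvd card (\<Union> ?C)"
    using fin E_eq by (intro dvd_partition) (auto simp: pairwise_def disjnt_def)
  then have "p dvd card E - 1"
    using x fin by (simp add: E_eq)
  moreover have "card E \<noteq> 0"
    using x fin by auto
  ultimately have "p dvd 1"
    using dvd by (metis One_nat_def Suc_pred dvd_add_right_iff not_gr_zero plus_1_eq_Suc add.commute)
  with p show False by simp
qed

context group
begin

text \<open>The inverse turns right multiplication into a left action; the restriction to
  \<open>rcosets K\<close> is the extensionality that \<open>Bij\<close> demands.\<close>

lemma coset_action:
  assumes K: "subgroup K G"
  shows "group_action G (rcosets K) (\<lambda>g. \<lambda>R \<in> rcosets K. R #> inv g)"
proof -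
  have KG: "K \<subseteq> carrier G" by (rule subgroup.subset[OF K])
  define \<phi> where "\<phi> = (\<lambda>g. \<lambda>R \<in> rcosets K. R #> inv g)"
  have mem: "R #> g \<in> rcosets K" if "R \<in> rcosets K" "g \<in> carrier G" for R g
    using that KG by (auto simp: RCOSETS_def coset_mult_assoc)
  have sub: "R \<subseteq> carrier G" if "R \<in> rcosets K" for R
    using that K rcosets_part_G by blast
  have bij: "\<phi> g \<in> Bij (rcosets K)" if g: "g \<in> carrier G" for g
  proof -
    have "bij_betw (\<phi> g) (rcosets K) (rcosets K)"
      by (rule bij_betw_byWitness[where f' = "\<lambda>R. R #> g"])
        (use g mem sub in \<open>auto simp: \<phi>_def coset_mult_assoc coset_mult_one\<close>)
    then show ?thesis by (simp add: Bij_def \<phi>_def)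
  qed
  have "\<phi> (g \<otimes> h) = compose (rcosets K) (\<phi> g) (\<phi> h)" if "g \<in> carrier G" "h \<in> carrier G" for g h
    unfolding compose_def
    using that mem sub by (auto simp: \<phi>_def fun_eq_iff inv_mult_group coset_mult_assoc)
  then have "\<phi> \<in> hom G (BijGroup (rcosets K))"
    using bij by (auto simp: hom_def BijGroup_def)
  then show ?thesis
    unfolding group_action_def group_hom_def group_hom_axioms_def \<phi>_def
    by (simp add: group_BijGroup)
qed

text \<open>\<open>K\<close> acts on its own right cosets, whose number is divisible by
  \<open>p\<close>, and fixes \<open>K\<close>. A second fixed coset \<open>K #> g\<close> satisfies
  \<open>K #> (g \<otimes> k) = K #> g\<close>, so \<open>g\<close> conjugates \<open>K\<close> into
  itself.\<close>

lemma p_group_normalizer_grows: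
  assumes p: "Factorial_Ring.prime p" and order: "order G = p ^ n" and K: "subgroup K G"
    and proper: "K \<noteq> carrier G"
  shows "\<exists>g \<in> carrier G - K. \<forall>k \<in> K. g \<otimes> k \<otimes> inv g \<in> K"
proof -
  have "order G > 0"
    using p order by (simp add: prime_gt_0_nat)
  then have fin: "finite (carrier G)"
    by (simp add: order_gt_0_iff_finite)
  have KG: "K \<subseteq> carrier G" by (rule subgroup.subset[OF K])
  have lag: "card (rcosets K) * card K = p ^ n"
    using lagrange[OF K] order by simp
  then have "card (rcosets K) dvd p ^ n" "card K dvd p ^ n"
    by (metis dvd_triv_left, metis dvd_triv_right)
  then obtain m l where m: "card (rcosets K) = p ^ m" and l: "card K = p ^ l"
    using p by (auto simp: divides_primepow_nat)
  have "m \<noteq> 0"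
  proof
    assume "m = 0"
    with m lag order have "card K = card (carrier G)"
      by (simp add: order_def)
    with proper fin KG show False
      using card_subset_eq by blast
  qed
  then have dvd: "p dvd card (rcosets K)"
    using m by simp
  interpret action: group_action "G\<lparr>carrier := K\<rparr>" "rcosets K" "\<lambda>g. \<lambda>R \<in> rcosets K. R #> inv g"
    using group_action.induced_action[OF coset_action[OF K] K] .
  have K_mem: "K \<in> rcosets K"
    using subgroup.subgroup_in_rcosets[OF K is_group] .
  have fixed: "K #> inv k = K" if "k \<in> K" for k
    using that K KG by (intro coset_join2) (auto intro: subgroup.m_inv_closed)
  have "\<exists>R \<in> rcosets K. R \<noteq> K \<and> (\<forall>g \<in> carrier (G\<lparr>carrier := K\<rparr>).
      (\<lambda>R \<in> rcosets K. R #> inv g) R = R)"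
  proof (rule action.second_fixed_point[OF p _ _ dvd K_mem])
    show "order (G\<lparr>carrier := K\<rparr>) = p ^ l"
      using l by (simp add: order_def)
    show "finite (rcosets K)"
      using dvd m p by (metis card.infinite not_prime_0 power_eq_0_iff)
  qed (use fixed K_mem in auto)
  then obtain R where R: "R \<in> rcosets K" "R \<noteq> K" "\<And>k. k \<in> K \<Longrightarrow> R #> inv k = R"
    by auto
  then obtain g where g: "g \<in> carrier G" "R = K #> g"
    by (auto simp: RCOSETS_def)
  have "g \<otimes> k \<otimes> inv g \<in> K" if k: "k \<in> K" for k
  proof -
    have kc: "k \<in> carrier G" using k KG by blast
    have "R #> k = R"
      using R(3)[of "inv k"] k kc subgroup.m_inv_closed[OF K k] by simp
    then have "K #> (g \<otimes> k) = K #> g"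
      using g kc KG by (simp add: coset_mult_assoc)
    then have "g \<otimes> k \<in> K #> g"
      using rcos_self[OF _ K, of "g \<otimes> k"] g kc by simp
    then show ?thesis
      using subgroup.rcos_module_imp[OF K is_group g(1)] by blast
  qed
  moreover have "g \<notin> K"
    using R(2) g coset_join2[OF g(1) K] by blast
  ultimately show ?thesis using g(1) by blast
qed

text \<open>\<open>M\<close> is maximal among the proper subgroups of \<open>H\<close> above
  \<open>K\<close>. Its normaliser in \<open>H\<close> is strictly larger, hence all of
  \<open>H\<close>.\<close>

lemma p_group_proper_subgroup_le_normal:
  assumes p: "Factorial_Ring.prime p" and order: "order G = p ^ n"
    and H: "subgroup H G" and K: "subgroup K G" and KH: "K \<subset> H"
  obtains M where "subgroup M G" "K \<subseteq> M" "M \<subset> H"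
    "\<And>m h. m \<in> M \<Longrightarrow> h \<in> H \<Longrightarrow> inv h \<otimes> m \<otimes> h \<in> M"
proof -
  have "order G > 0"
    using p order by (simp add: prime_gt_0_nat)
  then have fin: "finite (carrier G)"
    by (simp add: order_gt_0_iff_finite)
  have HG: "H \<subseteq> carrier G" by (rule subgroup.subset[OF H])
  define S where "S = {M. subgroup M G \<and> K \<subseteq> M \<and> M \<subset> H}"
  have "S \<subseteq> Pow H"
    unfolding S_def by (rule subsetI) (simp add: psubset_imp_subset)
  then have "finite S"
    using finite_subset[OF HG fin] by (rule finite_subset[OF _ finite_Pow_iff[THEN iffD2]])
  moreover have "K \<in> S"
    using K KH by (simp add: S_def)
  ultimately obtain M where M: "M \<in> S" and max: "\<And>M'. M' \<in> S \<Longrightarrow> M \<subseteq> M' \<Longrightarrow> M = M'"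
    using finite_has_maximal2[of S K] by metis
  have MG: "subgroup M G" and MH: "M \<subset> H" and KM: "K \<subseteq> M"
    using M by (simp_all add: S_def)
  have M_carr: "m \<in> carrier G" if "m \<in> M" for m
    using subgroup.mem_carrier[OF MG that] .
  have H_carr: "h \<in> carrier G" if "h \<in> H" for h
    using that HG by blast
  interpret H: group "G\<lparr>carrier := H\<rparr>"
    by (rule subgroup_imp_group[OF H])
  have "card H dvd p ^ n"
    using lagrange[OF H] order by (metis dvd_triv_right)
  then obtain l where l: "card H = p ^ l"
    using p by (auto simp: divides_primepow_nat)
  have "\<exists>g \<in> carrier (G\<lparr>carrier := H\<rparr>) - M. \<forall>m \<in> M.
      g \<otimes>\<^bsub>G\<lparr>carrier := H\<rparr>\<^esub> m \<otimes>\<^bsub>G\<lparr>carrier := H\<rparr>\<^esub> inv\<^bsub>G\<lparr>carrier := H\<rparr>\<^esub> g \<in> M"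
  proof (rule H.p_group_normalizer_grows[OF p])
    show "order (G\<lparr>carrier := H\<rparr>) = p ^ l"
      using l by (simp add: order_def)
    show "subgroup M (G\<lparr>carrier := H\<rparr>)"
      using subgroup_incl[OF MG H] MH by blast
  qed (use MH in auto)
  then obtain g where g: "g \<in> H" "g \<notin> M" and conj: "\<And>m. m \<in> M \<Longrightarrow> g \<otimes> m \<otimes> inv g \<in> M"
    using H by auto
  \<comment> \<open>The choice of \<open>g\<close> gives one inclusion; finiteness of
    \<open>M\<close> makes it an equality, so \<open>inv g\<close> conjugates \<open>M\<close> into
    itself as well.\<close>
  have image: "(\<lambda>m. g \<otimes> m \<otimes> inv g) ` M = M"
  proof (rule endo_inj_surj)
    show "finite M"
      by (rule finite_subset[OF psubset_imp_subset[OF MH] finite_subset[OF HG fin]])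
    show "inj_on (\<lambda>m. g \<otimes> m \<otimes> inv g) M"
      by (rule inj_onI) (rule conjugation_is_inj[OF H_carr[OF g(1)] M_carr M_carr])
    show "(\<lambda>m. g \<otimes> m \<otimes> inv g) ` M \<subseteq> M"
      by (rule image_subsetI) (rule conj)
  qed
  have conj': "inv g \<otimes> m \<otimes> g \<in> M" if "m \<in> M" for m
  proof -
    have "m \<in> (\<lambda>m. g \<otimes> m \<otimes> inv g) ` M"
      using that by (simp only: image)
    then obtain m' where m': "m' \<in> M" "m = g \<otimes> m' \<otimes> inv g"
      by (rule imageE)
    then have "inv g \<otimes> m \<otimes> g = m'"
      using M_carr H_carr[OF g(1)] by (simp add: group_word)
    with m' show ?thesis by simp
  qed
  \<comment> \<open>The normaliser of \<open>M\<close> in \<open>H\<close>; asking for both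
    directions makes closure under inverses immediate.\<close>
  define L where "L = {h \<in> H. \<forall>m \<in> M. inv h \<otimes> m \<otimes> h \<in> M \<and> h \<otimes> m \<otimes> inv h \<in> M}"
  have "subgroup L G"
  proof
    show "L \<subseteq> carrier G" using HG by (auto simp: L_def)
    show "\<one> \<in> L" using subgroup.one_closed[OF H] M_carr by (auto simp: L_def)
  next
    fix h assume "h \<in> L"
    then show "inv h \<in> L"
      using subgroup.m_inv_closed[OF H] H_carr by (auto simp: L_def)
  next
    fix h h' assume L: "h \<in> L" "h' \<in> L"
    then have hh': "h \<in> carrier G" "h' \<in> carrier G" "h \<otimes> h' \<in> H"
      using H_carr subgroup.m_closed[OF H] by (auto simp: L_def)
    have "inv (h \<otimes> h') \<otimes> m \<otimes> (h \<otimes> h') \<in> M \<and> h \<otimes> h' \<otimes> m \<otimes> inv (h \<otimes> h') \<in> M"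
      if m: "m \<in> M" for m
    proof -
      have "inv (h \<otimes> h') \<otimes> m \<otimes> (h \<otimes> h') = inv h' \<otimes> (inv h \<otimes> m \<otimes> h) \<otimes> h'"
        "h \<otimes> h' \<otimes> m \<otimes> inv (h \<otimes> h') = h \<otimes> (h' \<otimes> m \<otimes> inv h') \<otimes> inv h"
        using hh' M_carr[OF m] by (simp_all add: group_word)
      then show ?thesis using L m by (simp add: L_def)
    qed
    with hh' show "h \<otimes> h' \<in> L" by (simp add: L_def)
  qed
  moreover have "M \<subseteq> L"
  proof
    fix h assume h: "h \<in> M"
    then have "inv h \<in> M" by (rule subgroup.m_inv_closed[OF MG])
    then have "inv h' \<otimes> m \<otimes> h' \<in> M" if "m \<in> M" "h' \<in> {h, inv h}" for m h'
      using that h M_carr[OF h] by (elim insertE) (simp_all add: subgroup.m_closed[OF MG])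
    from this[of _ h] this[of _ "inv h"] show "h \<in> L"
      using h MH M_carr[OF h] by (auto simp: L_def)
  qed
  moreover have "g \<in> L"
    using g conj conj' by (simp add: L_def)
  ultimately have "L = H"
    using max[of L] KM g(2) unfolding S_def by (auto simp: L_def)
  then have "inv h \<otimes> m \<otimes> h \<in> M" if "m \<in> M" "h \<in> H" for m h
    using that by (auto simp: L_def)
  with that MG KM MH show thesis by blast
qed

end

section \<open>Finite p-central groups\<close>

context group
begin

lemma upper_central_commutator:
  assumes x: "x \<in> upper_central G (Suc k)" and y: "y \<in> carrier G"
  shows "cmt x y \<in> upper_central G k"
proof -
  interpret N: normal "upper_central G k" G
    by (rule upper_central_normal)
  let ?N = "upper_central G k"
  have "inv x \<in> upper_central G (Suc k)"
    using upper_central_normal x by (metis normal_imp_subgroup subgroup.m_inv_closed)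
  then have x': "inv x \<in> carrier G" "?N #> inv x \<in> group_center (G Mod ?N)"
    by simp_all
  have y': "inv y \<in> carrier G" "?N #> inv y \<in> carrier (G Mod ?N)"
    using y by (auto simp: FactGroup_def RCOSETS_def)
  have "(?N #> inv x) <#> (?N #> inv y) = (?N #> inv y) <#> (?N #> inv x)"
    using x'(2) y'(2) by (auto simp: group_center_def)
  then have eq: "?N #> (inv x \<otimes> inv y) = ?N #> (inv y \<otimes> inv x)"
    using x' y' by (simp add: N.rcos_sum)
  have "inv x \<otimes> inv y \<in> ?N #> (inv y \<otimes> inv x)"
    unfolding eq[symmetric] using x' y' N.subgroup_axioms by (intro rcos_self) auto
  then have "inv x \<otimes> inv y \<otimes> inv (inv y \<otimes> inv x) \<in> ?N"
    using x' y' N.rcos_module_imp[OF is_group] by blast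
  then show ?thesis
    using x y by (simp add: commutator_def inv_mult_group m_assoc)
qed

lemma upper_central_mono: "upper_central G k \<subseteq> upper_central G (Suc k)"
proof
  interpret N: normal "upper_central G k" G
    by (rule upper_central_normal)
  interpret Q: group "G Mod upper_central G k"
    by (rule N.factorgroup_is_group)
  fix x assume x: "x \<in> upper_central G k"
  then have xc: "x \<in> carrier G" by (rule N.mem_carrier)
  have "\<one>\<^bsub>G Mod upper_central G k\<^esub> \<in> group_center (G Mod upper_central G k)"
    unfolding group_center_def using Q.one_closed Q.l_one Q.r_one
    by (simp del: one_FactGroup mult_FactGroup)
  moreover have "upper_central G k #> x = \<one>\<^bsub>G Mod upper_central G k\<^esub>"
    using coset_join2[OF xc N.subgroup_axioms x] by (simp add: FactGroup_def)
  ultimately show "x \<in> upper_central G (Suc k)"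
    using xc by simp
qed

lemma upper_central_subgroup: "subgroup (upper_central G k) G"
  using upper_central_normal by (rule normal_imp_subgroup)

lemma upper_central_conj:
  "n \<in> upper_central G k \<Longrightarrow> h \<in> carrier G \<Longrightarrow> inv h \<otimes> n \<otimes> h \<in> upper_central G k"
  by (rule normal.inv_op_closed1[OF upper_central_normal])

text \<open>\<open>HZ\<close> bounds the class of \<open>H\<close> by \<open>Suc c\<close>: the
  subgroups \<open>upper_central G j \<inter> H\<close> for \<open>j \<le> c\<close>, followed by
  \<open>H\<close> itself, form a central series.\<close>

lemma power_quotient_upper_central:
  assumes p: "Factorial_Ring.prime p" and c: "Suc c < p"
    and H: "subgroup H G" and N: "subgroup N G"
    and HZ: "\<And>a b. a \<in> H \<Longrightarrow> b \<in> H \<Longrightarrow> cmt a b \<in> upper_central G c"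
    and HN: "\<And>a b. a \<in> H \<Longrightarrow> b \<in> H \<Longrightarrow> cmt a b \<in> N"
    and exponent: "\<And>u. u \<in> N \<Longrightarrow> u [^] p = \<one>"
    and x: "x \<in> H" and y: "y \<in> H"
  shows "inv (x [^] p) \<otimes> y [^] p = (inv x \<otimes> y) [^] p"
proof -
  note H_carr = subgroup.mem_carrier[OF H]
  have H_comm: "cmt a b \<in> H" if "a \<in> H" "b \<in> H" for a b
    unfolding commutator_def
    using that by (intro subgroup.m_closed[OF H] subgroup.m_inv_closed[OF H])
  define C where "C j = (if j \<le> c then upper_central G j \<inter> H else H)" for j
  show ?thesis
  proof (rule power_quotient_central_series[OF p c H N HN exponent _ _ _ _ _ x y, of C])
    show "subgroup (C j) G" for j
      using H upper_central_subgroup by (simp add: C_def subgroups_Inter_pair)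
    show "C 0 = {\<one>}"
      using subgroup.one_closed[OF H] by (auto simp: C_def)
    show "C j = H" if "Suc c \<le> j" for j
      using that by (simp add: C_def)
    show "C j \<subseteq> C (Suc j)" for j
      using upper_central_mono[of j] by (auto simp: C_def simp del: upper_central.simps)
    show "cmt a b \<in> C j" if a: "a \<in> C (Suc j)" and b: "b \<in> H" for j a b
    proof -
      have aH: "a \<in> H" using a by (simp add: C_def split: if_splits)
      consider "Suc j \<le> c" | "j = c" | "c < j" by linarith
      then show ?thesis
      proof cases
        case 1
        then have "cmt a b \<in> upper_central G j"
          using a H_carr[OF b] by (intro upper_central_commutator) (simp_all add: C_def)
        with H_comm[OF aH b] 1 show ?thesis by (simp add: C_def)
      qed (use H_comm[OF aH b] HZ[OF aH b] in \<open>simp_all add: C_def\<close>)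
    qed
  qed
qed

lemma conj_pow:
  fixes n :: nat
  assumes "x \<in> carrier G" "h \<in> carrier G"
  shows "(inv h \<otimes> x \<otimes> h) [^] n = inv h \<otimes> x [^] n \<otimes> h"
  using assms by (induction n) (simp_all add: m_assoc inv_cancel_left)

lemma generate_singleton_commute:
  assumes z: "z \<in> carrier G" and x: "x \<in> generate G {z}"
  shows "x \<otimes> z = z \<otimes> x"
proof -
  obtain k :: int where "x = z [^] k"
    using x generate_pow[OF z] by blast
  then show ?thesis
    using z int_pow_mult[OF z, of k 1] int_pow_mult[OF z, of 1 k] by (simp add: add.commute)
qed

end

section \<open>Elements of order dividing \<open>p\<close> and fibres of the power map\<close>

locale p_central_group = group +
  fixes p k i n :: nat
  assumes prime: "Factorial_Ring.prime p" and k: "k \<ge> 1" and i: "i \<ge> 1"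
    and height: "k \<le> p - 2 \<or> (k = p - 1 \<and> i \<ge> 2)"
    and order: "order G = p ^ n"
    and p_central: "\<And>x. x \<in> carrier G \<Longrightarrow> x [^] (p ^ i) = \<one> \<Longrightarrow> x \<in> upper_central G k"
begin

definition E :: "'a set" where
  "E = {x \<in> carrier G. x [^] p = \<one>}"

lemma finite_carrier: "finite (carrier G)"
proof -
  have "order G > 0"
    using prime order by (simp add: prime_gt_0_nat)
  then show ?thesis by (simp add: order_gt_0_iff_finite)
qed

lemma k_less: "k < p"
  using k height prime_gt_1_nat[OF prime] by auto

lemma E_carrier: "x \<in> E \<Longrightarrow> x \<in> carrier G"
  and E_pow: "x \<in> E \<Longrightarrow> x [^] p = \<one>"
  by (simp_all add: E_def)

lemma E_upper_central: "E \<subseteq> upper_central G k"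
proof
  fix x assume x: "x \<in> E"
  have "x [^] (p ^ i) = (x [^] p) [^] (p ^ (i - 1))"
    using E_carrier[OF x] i by (simp add: nat_pow_pow flip: power_Suc)
  then show "x \<in> upper_central G k"
    using p_central E_carrier E_pow x by simp
qed

lemma E_conj: "z \<in> E \<Longrightarrow> h \<in> carrier G \<Longrightarrow> inv h \<otimes> z \<otimes> h \<in> E"
  by (simp add: E_def conj_pow)

lemma E_inv: "z \<in> E \<Longrightarrow> inv z \<in> E"
  by (simp add: E_def nat_pow_inv)

text \<open>As \<open>z\<close> lies in \<open>upper_central G k\<close>, all commutators of the
  subgroup generated by \<open>x\<close> and \<open>z\<close> lie one term lower, so its class is at
  most \<open>k < p\<close>. \<open>N\<close> is kept general because \<open>E_mult\<close> applies
  this before \<open>E\<close> is known to be a subgroup.\<close>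

lemma power_quotient_pair:
  assumes x: "x \<in> carrier G" and z: "z \<in> upper_central G k" and N: "subgroup N G"
    and norm: "\<And>n h. n \<in> N \<Longrightarrow> h \<in> generate G {x, z} \<Longrightarrow> inv h \<otimes> n \<otimes> h \<in> N"
    and comm: "cmt x z \<in> N" and exponent: "\<And>u. u \<in> N \<Longrightarrow> u [^] p = \<one>"
    and u: "u \<in> generate G {x, z}" and v: "v \<in> generate G {x, z}"
  shows "inv (u [^] p) \<otimes> v [^] p = (inv u \<otimes> v) [^] p"
proof -
  have zc: "z \<in> carrier G"
    using subgroup.mem_carrier[OF upper_central_subgroup z] .
  have gen: "subgroup (generate G {x, z}) G"
    using x zc by (intro generate_is_subgroup) simp
  have k': "Suc (k - 1) = k" using k by simp
  have "cmt z x \<in> upper_central G (k - 1)"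
    using upper_central_commutator[of z "k - 1" x] z x by (simp only: k')
  then have xz: "cmt x z \<in> upper_central G (k - 1)"
    unfolding inv_commutator[OF zc x, symmetric]
    by (rule subgroup.m_inv_closed[OF upper_central_subgroup])
  have "cmt a b \<in> upper_central G (k - 1)"
    if "a \<in> generate G {x, z}" "b \<in> generate G {x, z}" for a b
    using upper_central_conj[OF _ subgroup.mem_carrier[OF gen]]
    by (rule generate_pair_commutator_closed[OF x zc upper_central_subgroup _ xz that])
  moreover have "cmt a b \<in> N"
    if "a \<in> generate G {x, z}" "b \<in> generate G {x, z}" for a b
    by (rule generate_pair_commutator_closed[OF x zc N norm comm that])
  moreover have "Suc (k - 1) < p"
    using k_less k' by simp
  ultimately show ?thesis
    using power_quotient_upper_central[OF prime _ gen N _ _ exponent u v] by blast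
qed

lemma card_less: "subgroup H G \<Longrightarrow> K \<subset> H \<Longrightarrow> card K < card H"
  using finite_subset[OF subgroup.subset finite_carrier] by (rule psubset_card_mono)

text \<open>Induction on the size of the generated subgroup. If \<open>z\<close> alone does not
  generate it, it has a proper normal subgroup \<open>M\<close> containing \<open>z\<close>; by
  induction \<open>M \<inter> E\<close> is a subgroup, and it serves as \<open>N\<close> in
  \<open>power_quotient_pair\<close>.\<close>

lemma E_mult: "x \<in> E \<Longrightarrow> z \<in> E \<Longrightarrow> x \<otimes> z \<in> E"
proof (induction "card (generate G {x, z})" arbitrary: x z rule: less_induct)
  case less
  note x = \<open>x \<in> E\<close> and z = \<open>z \<in> E\<close>
  note xc = E_carrier[OF x] and zc = E_carrier[OF z]
  let ?H = "generate G {x, z}"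
  have H: "subgroup ?H G" and Z: "subgroup (generate G {z}) G"
    using xc zc by (intro generate_is_subgroup; simp)+
  have xH: "x \<in> ?H" and zH: "z \<in> ?H"
    by (auto intro: generate.incl)
  show ?case
  proof (cases "generate G {z} = ?H")
    case True
    then have "x \<otimes> z = z \<otimes> x"
      using generate_singleton_commute[OF zc] xH by simp
    then show ?thesis
      using x z by (simp add: E_def pow_mult_distrib)
  next
    case False
    then have "generate G {z} \<subset> ?H"
      using mono_generate[of "{z}" "{x, z}"] by blast
    from p_group_proper_subgroup_le_normal[OF prime order H Z this]
    obtain M where M: "subgroup M G" "generate G {z} \<subseteq> M" "M \<subset> ?H"
      and norm: "\<And>m h. m \<in> M \<Longrightarrow> h \<in> ?H \<Longrightarrow> inv h \<otimes> m \<otimes> h \<in> M"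
      by metis
    have zM: "z \<in> M"
      using M(2) generate.incl[of z "{z}"] by blast
    have ME: "a \<otimes> b \<in> M \<inter> E" if ab: "a \<in> M \<inter> E" "b \<in> M \<inter> E" for a b
    proof -
      have "generate G {a, b} \<subseteq> M"
        using ab by (intro generate_subgroup_incl[OF _ M(1)]) simp
      then have "card (generate G {a, b}) < card ?H"
        using card_less[OF H] M(3) by (meson subset_psubset_trans)
      then have "a \<otimes> b \<in> E"
        using less.hyps ab by blast
      with ab subgroup.m_closed[OF M(1)] show ?thesis by simp
    qed
    have sub: "subgroup (M \<inter> E) G"
    proof
      show "M \<inter> E \<subseteq> carrier G" using E_carrier by blast
      show "\<one> \<in> M \<inter> E" using subgroup.one_closed[OF M(1)] by (simp add: E_def)
      show "inv a \<in> M \<inter> E" if "a \<in> M \<inter> E" for a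
        using that subgroup.m_inv_closed[OF M(1)] E_inv by simp
    qed (rule ME)
    have conj: "inv h \<otimes> a \<otimes> h \<in> M \<inter> E" if "a \<in> M \<inter> E" "h \<in> ?H" for a h
      using that norm E_conj subgroup.mem_carrier[OF H] by simp
    have xz: "cmt x z \<in> M \<inter> E"
    proof -
      have "inv z \<in> M \<inter> E" using zM z E_inv subgroup.m_inv_closed[OF M(1)] by simp
      from ME[OF conj[OF this xH], of z] zM z show ?thesis
        by (simp add: commutator_def)
    qed
    have "inv (x [^] p) \<otimes> (x \<otimes> z) [^] p = (inv x \<otimes> (x \<otimes> z)) [^] p"
    proof (rule power_quotient_pair[OF xc subsetD[OF E_upper_central z] sub conj])
      show "x \<otimes> z \<in> ?H" by (rule subgroup.m_closed[OF H xH zH])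
      show "cmt x z \<in> M \<inter> E" by (rule xz)
    qed (use xH E_pow in simp_all)
    then show ?thesis
      using x z by (simp add: E_def inv_cancel_left)
  qed
qed

lemma E_normal: "E \<lhd> G"
proof -
  have "subgroup E G"
  proof
    show "E \<subseteq> carrier G" using E_carrier by blast
    show "\<one> \<in> E" by (simp add: E_def)
  qed (rule E_mult E_inv; assumption)+
  moreover have "h \<otimes> z \<otimes> inv h \<in> E" if "h \<in> carrier G" "z \<in> E" for h z
    using E_conj[OF that(2) inv_closed[OF that(1)]] that(1) by simp
  ultimately show ?thesis by (simp add: normal_inv_iff)
qed

lemma E_subgroup: "subgroup E G"
  using E_normal by (rule normal_imp_subgroup)

text \<open>Now that \<open>E\<close> is a normal subgroup, it can itself serve as \<open>N\<close>.
  The result puts each left coset of \<open>E\<close> inside one fibre of the power map.\<close>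

lemma pow_mult_E:
  assumes x: "x \<in> carrier G" and z: "z \<in> E"
  shows "(x \<otimes> z) [^] p = x [^] p"
proof -
  have zc: "z \<in> carrier G" by (rule E_carrier[OF z])
  have H: "subgroup (generate G {x, z}) G"
    using x zc by (intro generate_is_subgroup) simp
  have xH: "x \<in> generate G {x, z}" "z \<in> generate G {x, z}"
    by (auto intro: generate.incl)
  have xz: "cmt x z \<in> E"
    unfolding commutator_def by (rule E_mult[OF E_conj[OF E_inv[OF z] x] z])
  have "inv (x [^] p) \<otimes> (x \<otimes> z) [^] p = (inv x \<otimes> (x \<otimes> z)) [^] p"
  proof (rule power_quotient_pair[OF x subsetD[OF E_upper_central z] E_subgroup])
    show "inv h \<otimes> a \<otimes> h \<in> E" if "a \<in> E" "h \<in> generate G {x, z}" for a h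
      using that E_conj subgroup.mem_carrier[OF H] by simp
    show "x \<otimes> z \<in> generate G {x, z}"
      by (rule subgroup.m_closed[OF H xH])
    show "cmt x z \<in> E" by (rule xz)
  qed (use xH E_pow in simp_all)
  also have "\<dots> = \<one>"
    using x zc z by (simp add: inv_cancel_left E_pow)
  finally show ?thesis
    using x zc by (simp add: inv_solve_left')
qed

text \<open>Modulo \<open>E\<close> the elements \<open>x\<close> and \<open>y\<close> commute, so
  the \<open>p\<close>-th power of \<open>inv x \<otimes> y\<close> becomes a product of
  \<open>p\<close>-th powers, which is trivial.\<close>

lemma pow_inv_mult_mem_E:
  assumes x: "x \<in> carrier G" and y: "y \<in> carrier G" and eq: "x [^] p = y [^] p"
    and comm: "cmt x y \<in> E"
  shows "(inv x \<otimes> y) [^] p \<in> E"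
proof -
  interpret N: normal E G by (rule E_normal)
  interpret Q: group "G Mod E" by (rule N.factorgroup_is_group)
  interpret h: group_hom G "G Mod E" "\<lambda>x. E #> x"
    by unfold_locales (rule N.r_coset_hom_Mod)
  have ker: "E #> u = \<one>\<^bsub>G Mod E\<^esub> \<longleftrightarrow> u \<in> E" if "u \<in> carrier G" for u
    using that N.subgroup_axioms coset_join1 coset_join2 N.subset
    by (metis one_FactGroup)
  let ?a = "E #> inv x" and ?b = "E #> y"
  have ab: "?a \<in> carrier (G Mod E)" "?b \<in> carrier (G Mod E)"
    using x y h.hom_closed by auto
  have c': "cmt (inv x) y \<in> E"
  proof -
    have "cmt (inv x) y = inv (inv x) \<otimes> inv (cmt x y) \<otimes> inv x"
      using x y by (simp add: commutator_inv_left)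
    then show ?thesis
      using E_conj[OF E_inv[OF comm] inv_closed[OF x]] by simp
  qed
  have "inv x \<otimes> y = y \<otimes> inv x \<otimes> cmt (inv x) y"
    using x y by (simp add: group_word)
  moreover have "?a \<otimes>\<^bsub>G Mod E\<^esub> ?b = E #> (inv x \<otimes> y)"
    using x y by (intro h.hom_mult[symmetric]) simp_all
  ultimately have "?a \<otimes>\<^bsub>G Mod E\<^esub> ?b = E #> (y \<otimes> inv x \<otimes> cmt (inv x) y)"
    by (simp only:)
  also have "\<dots> = (E #> (y \<otimes> inv x)) \<otimes>\<^bsub>G Mod E\<^esub> (E #> cmt (inv x) y)"
    using x y by (intro h.hom_mult) auto
  also have "E #> cmt (inv x) y = \<one>\<^bsub>G Mod E\<^esub>"
    using ker c' x y by simp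
  also have "(E #> (y \<otimes> inv x)) \<otimes>\<^bsub>G Mod E\<^esub> \<one>\<^bsub>G Mod E\<^esub> = E #> (y \<otimes> inv x)"
    by (rule Q.r_one[OF h.hom_closed]) (use x y in simp)
  also have "\<dots> = ?b \<otimes>\<^bsub>G Mod E\<^esub> ?a"
    using x y by (intro h.hom_mult) auto
  finally have "?a \<otimes>\<^bsub>G Mod E\<^esub> ?b = ?b \<otimes>\<^bsub>G Mod E\<^esub> ?a" .
  from Q.pow_mult_distrib[OF this ab, of p]
  have "E #> (inv x \<otimes> y) [^] p = E #> ((inv x) [^] p \<otimes> y [^] p)"
    using x y by (simp add: h.hom_mult h.hom_nat_pow)
  also have "(inv x) [^] p \<otimes> y [^] p = \<one>"
    using x y eq by (simp add: nat_pow_inv)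
  finally show ?thesis
    using ker x y h.hom_one by auto
qed

text \<open>The converse of \<open>pow_mult_E\<close>. Induction on the size of the generated
  subgroup yields \<open>cmt x y \<in> E\<close>; the two cases of \<open>height\<close> then differ
  in how the class is kept below \<open>p\<close>.\<close>

lemma quotient_mem_E:
  "x \<in> carrier G \<Longrightarrow> y \<in> carrier G \<Longrightarrow> x [^] p = y [^] p \<Longrightarrow> inv x \<otimes> y \<in> E"
proof (induction "card (generate G {x, y})" arbitrary: x y rule: less_induct)
  case less
  note x = \<open>x \<in> carrier G\<close> and y = \<open>y \<in> carrier G\<close> and eq = \<open>x [^] p = y [^] p\<close>
  let ?H = "generate G {x, y}"
  have H: "subgroup ?H G" and X: "subgroup (generate G {x}) G"
    using x y by (intro generate_is_subgroup; simp)+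
  have xH: "x \<in> ?H" and yH: "y \<in> ?H"
    by (auto intro: generate.incl)
  note H_carr = subgroup.mem_carrier[OF H]
  show ?case
  proof (cases "generate G {x} = ?H")
    case True
    then have "y \<otimes> x = x \<otimes> y"
      using generate_singleton_commute[OF x] yH by simp
    then have "inv x \<otimes> y = y \<otimes> inv x"
      using x y by (metis inv_closed inv_solve_left' inv_solve_right m_assoc m_closed)
    then have "(inv x \<otimes> y) [^] p = (inv x) [^] p \<otimes> y [^] p"
      using x y by (intro pow_mult_distrib) auto
    then show ?thesis
      using x y eq by (simp add: E_def nat_pow_inv)
  next
    case False
    then have "generate G {x} \<subset> ?H"
      using mono_generate[of "{x}" "{x, y}"] by blast
    from p_group_proper_subgroup_le_normal[OF prime order H X this]
    obtain M where M: "subgroup M G" "generate G {x} \<subseteq> M" "M \<subset> ?H"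
      and norm: "\<And>m h. m \<in> M \<Longrightarrow> h \<in> ?H \<Longrightarrow> inv h \<otimes> m \<otimes> h \<in> M"
      by metis
    have xM: "x \<in> M"
      using M(2) generate.incl[of x "{x}"] by blast
    let ?x' = "inv y \<otimes> x \<otimes> y"
    have "generate G {x, ?x'} \<subseteq> M"
      using xM norm[OF xM yH] by (intro generate_subgroup_incl[OF _ M(1)]) simp
    then have "card (generate G {x, ?x'}) < card ?H"
      using card_less[OF H] M(3) by (meson subset_psubset_trans)
    moreover have "x [^] p = ?x' [^] p"
    proof -
      have "?x' [^] p = inv y \<otimes> y [^] p \<otimes> y"
        using x y eq by (simp add: conj_pow)
      also have "y [^] p \<otimes> y = y \<otimes> y [^] p"
        using y by (metis nat_pow_Suc nat_pow_Suc2)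
      then have "inv y \<otimes> y [^] p \<otimes> y = y [^] p"
        using y by (simp add: m_assoc inv_cancel_left)
      finally show ?thesis using eq by simp
    qed
    ultimately have "inv x \<otimes> ?x' \<in> E"
      using less.hyps x y by simp
    then have xy: "cmt x y \<in> E"
      using x y by (simp add: commutator_def m_assoc)
    have HE: "cmt a b \<in> E" if "a \<in> ?H" "b \<in> ?H" for a b
      using E_conj[OF _ H_carr] by (rule generate_pair_commutator_closed[OF x y E_subgroup _ xy that])
    have "inv (x [^] p) \<otimes> y [^] p = (inv x \<otimes> y) [^] p"
      using height
    proof
      assume "k \<le> p - 2"
      \<comment> \<open>Commutators lie in \<open>E\<close>, hence in
        \<open>upper_central G k\<close>, so the class is at most \<open>Suc k\<close>. Since
        \<open>k \<ge> 1\<close>, the subtraction in \<open>p - 2\<close> is not truncated.\<close>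
      then have "Suc k < p" using k by simp
      then show ?thesis
        using H E_subgroup by (rule power_quotient_upper_central[OF prime _ _ _ _ HE E_pow xH yH])
          (use HE E_upper_central in auto)
    next
      assume i2: "k = p - 1 \<and> i \<ge> 2"
      define w where "w = inv x \<otimes> y"
      have w: "w \<in> carrier G" "w \<in> ?H" and y_eq: "y = x \<otimes> w"
        using x y subgroup.m_closed[OF H subgroup.m_inv_closed[OF H xH] yH]
        by (simp_all add: w_def inv_cancel_left)
      have "w [^] (p ^ i) = ((w [^] p) [^] p) [^] (p ^ (i - 2))"
      proof -
        have "p ^ i = p\<^sup>2 * p ^ (i - 2)"
          using i2 by (metis le_add_diff_inverse power_add)
        then show ?thesis using w(1) by (simp add: nat_pow_pow power2_eq_square)
      qed
      \<comment> \<open>\<open>w [^] p\<close> lies in \<open>E\<close>, so \<open>w\<close> has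
        order dividing \<open>p * p\<close>, and \<open>i \<ge> 2\<close> brings it under
        \<open>p_central\<close>.\<close>
      then have "w \<in> upper_central G k"
        using E_pow[OF pow_inv_mult_mem_E[OF x y eq xy]] w(1) by (intro p_central) (simp_all add: w_def)
      then show ?thesis
      proof (rule power_quotient_pair[OF x _ E_subgroup])
        have W: "subgroup (generate G {x, w}) G"
          using x w by (intro generate_is_subgroup) simp
        show "inv h \<otimes> a \<otimes> h \<in> E" if "a \<in> E" "h \<in> generate G {x, w}" for a h
          using that E_conj subgroup.mem_carrier[OF W] by simp
        show "x \<in> generate G {x, w}" by (rule generate.incl) simp
        then show "y \<in> generate G {x, w}"
          unfolding y_eq by (rule subgroup.m_closed[OF W]) (rule generate.incl, simp)
        show "cmt x w \<in> E" by (rule HE[OF xH w(2)])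
      qed (rule E_pow)
    qed
    then show ?thesis
      using x y eq by (simp add: E_def)
  qed
qed

text \<open>By \<open>pow_mult_E\<close> and \<open>quotient_mem_E\<close>, the nonempty fibres of
  the power map are left cosets of \<open>E\<close>, so all have the same size.\<close>

lemma card_power_set: "card (power_set p G) * card E = order G"
proof -
  have fibre: "card {x \<in> carrier G. x [^] p = y} = card E" if y: "y \<in> power_set p G" for y
  proof -
    obtain a where a: "a \<in> carrier G" "y = a [^] p"
      using y by (auto simp: power_set_def)
    have "{x \<in> carrier G. x [^] p = y} = (\<lambda>z. a \<otimes> z) ` E"
    proof
      show "{x \<in> carrier G. x [^] p = y} \<subseteq> (\<lambda>z. a \<otimes> z) ` E"
      proof
        fix x assume "x \<in> {x \<in> carrier G. x [^] p = y}"
        then have x: "x \<in> carrier G" "x [^] p = a [^] p" using a by auto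
        show "x \<in> (\<lambda>z. a \<otimes> z) ` E"
          by (rule image_eqI[of _ _ "inv a \<otimes> x"])
            (use x a quotient_mem_E[of a x] in \<open>simp_all add: inv_cancel_left\<close>)
      qed
      show "(\<lambda>z. a \<otimes> z) ` E \<subseteq> {x \<in> carrier G. x [^] p = y}"
        using a pow_mult_E E_carrier by auto
    qed
    moreover have "inj_on (\<lambda>z. a \<otimes> z) E"
      using a E_carrier by (auto simp: inj_on_def)
    ultimately show ?thesis by (simp add: card_image)
  qed
  have image: "power_set p G = (\<lambda>x. x [^] p) ` carrier G"
    by (auto simp: power_set_def)
  have "order G = (\<Sum>y \<in> power_set p G. card {x \<in> carrier G. x [^] p = y})"
    using sum.image_gen[OF finite_carrier, of "\<lambda>_. 1 :: nat" "\<lambda>x. x [^] p"]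
    by (simp add: order_def image)
  then show ?thesis using fibre by simp
qed

lemma Omega_1: "Omega p 1 G = E"
proof -
  have "Omega p 1 G = generate G E"
    by (simp add: Omega_def E_def)
  also have "\<dots> = E"
    using generate_subgroup_incl[OF subset_refl E_subgroup] by (auto intro: generate.incl)
  finally show ?thesis .
qed

text \<open>Lagrange's theorem and \<open>card_power_set\<close> both factor \<open>order G\<close>.
  The powers lie in the subgroup they generate, so comparing factors gives the inequality, and
  equality when the two sets coincide.\<close>

lemma index_power_subgroup:
  "group_index G (power_subgroup p G) \<le> card (Omega p 1 G) \<and>
    (power_subgroup p G = power_set p G \<longrightarrow>
      group_index G (power_subgroup p G) = card (Omega p 1 G))"
proof -
  let ?A = "power_subgroup p G" and ?B = "power_set p G"
  have B: "?B \<subseteq> carrier G" by (auto simp: power_set_def)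
  have A: "subgroup ?A G" and BA: "?B \<subseteq> ?A"
    using generate_is_subgroup[OF B] by (auto simp: power_subgroup_def intro: generate.incl)
  have fin: "finite ?A"
    by (rule finite_subset[OF subgroup.subset[OF A] finite_carrier])
  have pos: "0 < card ?A"
    using fin subgroup.one_closed[OF A] by (auto simp: card_gt_0_iff)
  have eq: "group_index G ?A * card ?A = card ?B * card E"
    using lagrange[OF A] card_power_set by (simp add: group_index_def)
  have "\<dots> \<le> card E * card ?A"
    using card_mono[OF fin BA] by (simp add: mult.commute)
  then have "group_index G ?A * card ?A \<le> card E * card ?A"
    by (simp only: eq)
  then have "group_index G ?A \<le> card E"
    using pos by (simp only: mult_le_cancel2)
  moreover have "group_index G ?A = card E" if "?A = ?B"
    using eq pos that by (simp add: mult.commute)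
  ultimately show ?thesis unfolding Omega_1 by blast
qed

end

theorem theoremC:
  fixes p k i :: nat and P :: "('a, 'b) monoid_scheme"
  assumes "Factorial_Ring.prime p" and "k \<ge> 1" and "i \<ge> 1"
    and "k \<le> p - 2 \<or> (k = p - 1 \<and> i \<ge> 2)"
    and "finite_p_group p P"
    and "central_of_height p i k P"
  shows "group_index P (power_subgroup p P) \<le> card (Omega p 1 P) \<and>
    (power_subgroup p P = power_set p P \<longrightarrow>
      group_index P (power_subgroup p P) = card (Omega p 1 P))"
proof -
  obtain n where P: "group P" and n: "order P = p ^ n"
    using assms(5) by (auto simp: finite_p_group_def)
  \<comment> \<open>The locale states the height condition on the generators of
    \<open>Omega p i P\<close>.\<close>
  have central: "x \<in> upper_central P k" if "x \<in> carrier P" "x [^]\<^bsub>P\<^esub> (p ^ i) = \<one>\<^bsub>P\<^esub>" for x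
    using assms(6) that by (auto simp: central_of_height_def Omega_def intro: generate.incl)
  interpret p_central_group P p k i n
    by (rule p_central_group.intro[OF P p_central_group_axioms.intro[OF assms(1-4) n central]])
  show ?thesis by (rule index_power_subgroup)
qed

end
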